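(* Let $A\in\mathbb{R}^{m\times n}$ have full row rank, let $b\in\mathbb{R}^m\setminus\{0\}$, and consider the problem $$\min_{x\in\mathbb{R}^n}\ \frac{\|x\|_1}{\|x\|}\quad\text{subject to}\quad Ax=b.$$ Suppose that $\ker A$ has the $s$-spherical section property for some $s>0$ and that there exists $\widetilde x\in\mathbb{R}^n$ such that $\|\widetilde x\|_0<m/s$ and $A\widetilde x=b$. Then the optimal value of this problem is attained, i.e., its set of optimal solutions is nonempty.
   Context: $\|\cdot\|$ is the Euclidean norm, $\|\cdot\|_1$ the $\ell_1$ norm, and $\|x\|_0$ the number of nonzero entries of $x$. Spherical section property: let $m<n$ be positive integers, let $V$ be an $(n-m)$-dimensional subspace of $\mathbb{R}^n$ and let $s$ be a positive integer. $V$ has the $s$-spherical section property if $\inf_{v\in V\setminus\{0\}}\frac{\|v\|_1}{\|v\|}\ge\sqrt{m/s}$. (Thus, when this property is invoked for $\ker A$, it is understood that $m<n$ and $s$ is a positive integer.) *)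

theory Defs
  imports "HOL-Analysis.Analysis"
begin

definition l1_norm :: "real ^ 'n \<Rightarrow> real"
  where "l1_norm x = (\<Sum>i\<in>UNIV. \<bar>x $ i\<bar>)"

definition l0_norm :: "real ^ 'n \<Rightarrow> nat"
  where "l0_norm x = card {i. x $ i \<noteq> 0}"

text \<open>At \<open>x = 0\<close> this is \<open>0 / 0 = 0\<close>; below it is only used at nonzero vectors.\<close>

definition l1_l2_ratio :: "real ^ 'n \<Rightarrow> real"
  where "l1_l2_ratio x = l1_norm x / norm x"

definition ker :: "real ^ 'n ^ 'm \<Rightarrow> (real ^ 'n) set"
  where "ker A = {x. A *v x = 0}"

text \<open>The requirements \<open>0 < m < n\<close> and \<open>s > 0\<close> belong to the definition.  They make \<open>V\<close>
  nontrivial, so the infimum is over a nonempty set that is bounded below by \<open>0\<close>.\<close>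

definition spherical_section_property :: "nat \<Rightarrow> nat \<Rightarrow> (real ^ 'n) set \<Rightarrow> bool"
  where "spherical_section_property m s V \<longleftrightarrow>
    0 < m \<and> m < CARD('n) \<and> 0 < s \<and> subspace V \<and> dim V = CARD('n) - m \<and>
    (INF v\<in>V - {0}. l1_l2_ratio v) \<ge> sqrt (real m / real s)"

text \<open>If \<open>b \<noteq> 0\<close>, no feasible point is zero, so the objective is never evaluated at \<open>0\<close>.\<close>

definition optimal_solutions :: "real ^ 'n ^ 'm \<Rightarrow> real ^ 'm \<Rightarrow> (real ^ 'n) set"
  where "optimal_solutions A b = {x. is_arg_min l1_l2_ratio (\<lambda>y. A *v y = b) x}"

end

theory Submission
  imports Defs
begin

text \<open>
  The feasible set is closed and, as \<open>b \<noteq> 0\<close>, avoids the origin, where the ratio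
  \<open>\<parallel>x\<parallel>\<^sub>1 / \<parallel>x\<parallel>\<close> is discontinuous; so a minimum can only fail to exist if minimizing sequences
  run off to infinity.  The ratio is constant on rays, and the normalizations of solutions of
  \<open>A x = b\<close> whose norms tend to infinity accumulate only at unit vectors of the kernel of \<open>A\<close>; so
  the ratios along such a sequence have a lower limit no smaller than the infimum over the nonzero
  kernel vectors, which the spherical section property bounds below by \<open>\<surd>(m / s)\<close>.  On the other
  hand, by the Cauchy-Schwarz inequality, the ratio of a vector with \<open>k\<close> nonzero entries is at
  most \<open>\<surd>k\<close>.
  The sparse feasible point thus has a ratio \<open>r < \<surd>(m / s)\<close>, and the feasible points with ratio at
  most \<open>r\<close> form a bounded set (\<open>bounded_ratio_sublevel\<close>), hence a nonempty compact one, on which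
  the minimum is attained (\<open>optimal_solutions_nonempty_if_ratio_below_kernel\<close>).

  The cone of vectors with ratio at most \<open>r\<close> is written \<open>\<parallel>x\<parallel>\<^sub>1 \<le> r \<parallel>x\<parallel>\<close>, because in this form it
  is visibly closed, also at the origin.
\<close>

lemma continuous_on_l1_norm: "continuous_on S l1_norm"
  unfolding l1_norm_def by (intro continuous_intros)

lemma l1_norm_scaleR: "l1_norm (c *\<^sub>R x) = \<bar>c\<bar> * l1_norm x"
  by (simp add: l1_norm_def abs_mult sum_distrib_left)

lemma l1_l2_ratio_nonneg: "0 \<le> l1_l2_ratio x"
  by (simp add: l1_l2_ratio_def l1_norm_def sum_nonneg)

lemma l1_l2_ratio_le_iff: "x \<noteq> 0 \<Longrightarrow> l1_l2_ratio x \<le> r \<longleftrightarrow> l1_norm x \<le> r * norm x"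
  by (simp add: l1_l2_ratio_def divide_le_eq)

text \<open>The \<open>\<ell>\<^sub>1\<close> norm is the inner product of \<open>x\<close> with its vector of signs, whose Euclidean norm is
  the square root of the number of nonzero entries; so this is the Cauchy-Schwarz inequality.\<close>

lemma l1_norm_le_sqrt_l0_norm:
  fixes x :: "real ^ 'n"
  shows "l1_norm x \<le> sqrt (real (l0_norm x)) * norm x"
proof -
  define \<sigma> :: "real ^ 'n" where "\<sigma> = (\<chi> i. sgn (x $ i))"
  have "\<sigma> \<bullet> \<sigma> = (\<Sum>i\<in>UNIV. if x $ i \<noteq> 0 then 1 else 0)"
    unfolding inner_vec_def \<sigma>_def by (intro sum.cong) (auto simp: sgn_if)
  also have "\<dots> = real (l0_norm x)"
    by (simp add: l0_norm_def flip: sum.inter_filter)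
  finally have norm_\<sigma>: "norm \<sigma> = sqrt (real (l0_norm x))"
    by (simp add: norm_eq_sqrt_inner)
  have "l1_norm x = \<sigma> \<bullet> x"
    unfolding l1_norm_def inner_vec_def \<sigma>_def by (intro sum.cong) (auto simp: sgn_if)
  also have "\<dots> \<le> norm \<sigma> * norm x"
    by (rule norm_cauchy_schwarz)
  finally show ?thesis
    by (simp add: norm_\<sigma>)
qed

lemma l1_l2_ratio_le_sqrt_l0_norm: "l1_l2_ratio x \<le> sqrt (real (l0_norm x))"
proof (cases "x = 0")
  case True
  then show ?thesis by (simp add: l1_l2_ratio_def)
next
  case False
  then show ?thesis by (simp add: l1_l2_ratio_le_iff l1_norm_le_sqrt_l0_norm)
qed

lemma spherical_section_property_imp_ratio_ge:
  assumes "spherical_section_property m s V" and "v \<in> V" and "v \<noteq> 0"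
  shows "sqrt (real m / real s) \<le> l1_l2_ratio v"
proof -
  have "bdd_below (l1_l2_ratio ` (V - {0}))"
    by (rule bdd_belowI[of _ 0]) (auto simp: l1_l2_ratio_nonneg)
  then have "(INF v\<in>V - {0}. l1_l2_ratio v) \<le> l1_l2_ratio v"
    using assms(2,3) by (intro cINF_lower) auto
  then show ?thesis
    using assms(1) unfolding spherical_section_property_def by linarith
qed

text \<open>The unit vectors of the cone \<open>\<parallel>x\<parallel>\<^sub>1 \<le> r \<parallel>x\<parallel>\<close> form a compact set that misses the kernel, so
  \<open>\<parallel>A u\<parallel>\<close> is bounded below on it by a positive \<open>\<delta>\<close>.  By homogeneity \<open>\<parallel>A x\<parallel> \<ge> \<delta> \<parallel>x\<parallel>\<close> on the whole
  cone, which bounds the solutions of \<open>A x = b\<close> in it by \<open>\<parallel>b\<parallel> / \<delta>\<close>.\<close>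

lemma bounded_ratio_sublevel:
  fixes A :: "real ^ 'n ^ 'm"
  assumes kernel: "\<And>v. v \<in> ker A \<Longrightarrow> v \<noteq> 0 \<Longrightarrow> r < l1_l2_ratio v"
  shows "bounded {x. A *v x = b \<and> l1_norm x \<le> r * norm x}"
proof -
  define K where "K = sphere 0 1 \<inter> {u :: real ^ 'n. l1_norm u \<le> r * norm u}"
  have "closed {u :: real ^ 'n. l1_norm u \<le> r * norm u}"
    by (intro closed_Collect_le continuous_on_l1_norm continuous_intros)
  then have "compact K"
    unfolding K_def by (intro compact_Int_closed compact_sphere)
  have pos: "0 < norm (A *v u)" if "u \<in> K" for u
  proof -
    have "u \<noteq> 0"
      using that by (auto simp: K_def)
    moreover from this have "l1_l2_ratio u \<le> r"
      using that by (auto simp: K_def l1_l2_ratio_le_iff)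
    ultimately have "u \<notin> ker A"
      using kernel[of u] by auto
    then show ?thesis
      by (simp add: ker_def)
  qed
  obtain \<delta> where "0 < \<delta>" and \<delta>: "\<And>u. u \<in> K \<Longrightarrow> \<delta> \<le> norm (A *v u)"
  proof (cases "K = {}")
    case True
    then show thesis using that[of 1] by simp
  next
    case False
    have "continuous_on K (\<lambda>u. norm (A *v u))"
      by (intro continuous_intros linear_continuous_on) (simp add: linear_linear)
    then obtain u0 where "u0 \<in> K" "\<forall>u\<in>K. norm (A *v u0) \<le> norm (A *v u)"
      using continuous_attains_inf[OF \<open>compact K\<close> False] by blast
    then show thesis using that[of "norm (A *v u0)"] pos by blast
  qed
  have "norm x \<le> norm b / \<delta>" if "A *v x = b" "l1_norm x \<le> r * norm x" for x
  proof (cases "x = 0")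
    case True
    then show ?thesis using \<open>0 < \<delta>\<close> by simp
  next
    case False
    define u where "u = (1 / norm x) *\<^sub>R x"
    have "u \<in> K"
      using that(2) False by (simp add: K_def u_def l1_norm_scaleR divide_le_eq)
    have "A *v x = norm x *\<^sub>R (A *v u)"
      using False by (simp add: u_def flip: matrix_vector_mult_scaleR)
    then have norm_b: "norm b = norm (A *v u) * norm x"
      using that(1) by simp
    have "\<delta> * norm x \<le> norm b"
      unfolding norm_b using \<delta>[OF \<open>u \<in> K\<close>] by (intro mult_right_mono) auto
    then show ?thesis
      using \<open>0 < \<delta>\<close> by (simp add: pos_le_divide_eq mult.commute)
  qed
  then show ?thesis
    by (intro boundedI[of _ "norm b / \<delta>"]) auto
qed

text \<open>It suffices to minimize over the feasible points that are at least as good as the given one;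
  these form a compact set that avoids the origin since \<open>b \<noteq> 0\<close>.\<close>

lemma optimal_solutions_nonempty_if_ratio_below_kernel:
  fixes A :: "real ^ 'n ^ 'm"
  assumes "b \<noteq> 0" and "A *v x0 = b"
    and kernel: "\<And>v. v \<in> ker A \<Longrightarrow> v \<noteq> 0 \<Longrightarrow> l1_l2_ratio x0 < l1_l2_ratio v"
  shows "optimal_solutions A b \<noteq> {}"
proof -
  define r where "r = l1_l2_ratio x0"
  define S where "S = {x. A *v x = b \<and> l1_norm x \<le> r * norm x}"
  have nonzero: "x \<noteq> 0" if "A *v x = b" for x
    using that \<open>b \<noteq> 0\<close> by auto
  have S_iff: "x \<in> S \<longleftrightarrow> A *v x = b \<and> l1_l2_ratio x \<le> r" for x
    using nonzero[of x] by (auto simp: S_def l1_l2_ratio_le_iff)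
  have "closed S"
    unfolding S_def
    by (intro closed_Collect_conj closed_Collect_eq closed_Collect_le continuous_on_l1_norm
        continuous_intros linear_continuous_on) (simp_all add: linear_linear)
  moreover have "bounded S"
    unfolding S_def using kernel by (intro bounded_ratio_sublevel) (simp add: r_def)
  ultimately have "compact S"
    by (simp add: compact_eq_bounded_closed)
  moreover have "x0 \<in> S"
    using assms(2) by (simp add: S_iff r_def)
  moreover have "continuous_on S l1_l2_ratio"
    unfolding l1_l2_ratio_def
    using nonzero by (intro continuous_intros continuous_on_l1_norm) (auto simp: S_def)
  ultimately obtain x where "x \<in> S" and x: "\<And>y. y \<in> S \<Longrightarrow> l1_l2_ratio x \<le> l1_l2_ratio y"
    using continuous_attains_inf[of S l1_l2_ratio] by blast
  have "l1_l2_ratio x \<le> l1_l2_ratio y" if "A *v y = b" for y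
    using that x[of y] \<open>x \<in> S\<close> S_iff[of x] S_iff[of y] by fastforce
  then have "x \<in> optimal_solutions A b"
    using \<open>x \<in> S\<close> by (auto simp: optimal_solutions_def is_arg_min_linorder S_iff)
  then show ?thesis
    by blast
qed

theorem theorem3p4:
  fixes A :: "real ^ 'n ^ 'm" and b :: "real ^ 'm" and s :: nat
  assumes "rank A = CARD('m)"
    and "b \<noteq> 0"
    and "spherical_section_property CARD('m) s (ker A)"
    and "\<exists>x. real (l0_norm x) < real CARD('m) / real s \<and> A *v x = b"
  shows "optimal_solutions A b \<noteq> {}"
proof -
  obtain x0 where sparse: "real (l0_norm x0) < real CARD('m) / real s" and x0: "A *v x0 = b"
    using assms(4) by blast
  have "l1_l2_ratio x0 < sqrt (real CARD('m) / real s)"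
    using l1_l2_ratio_le_sqrt_l0_norm[of x0] real_sqrt_less_mono[OF sparse] by linarith
  then have "l1_l2_ratio x0 < l1_l2_ratio v" if "v \<in> ker A" "v \<noteq> 0" for v
    using spherical_section_property_imp_ratio_ge[OF assms(3) that] by linarith
  then show ?thesis
    using assms(2) x0 by (intro optimal_solutions_nonempty_if_ratio_below_kernel)
qed

end
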